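(* Let $r\ge 1$ and let $\{R_{\alpha,n}\}_{0\le\alpha\le r+1,\ n\in\mathbb Z}$ be the solution of the $A_r$ $Q$-system with initial data $(R_{\alpha,0},R_{\alpha,1})_{1\le \alpha\le r}$. Then for all $n\ge 0$, $$R_{1,n+1}=R_{1,1}\sum_{\substack{p_1,\dots,p_{2r+1}\ge 0\\ p_1+\cdots+p_{2r+1}=n}}\ \prod_{i=1}^{r}\frac{(R_{i,0})^{p_{2i+2}+p_{2i+1}-p_{2i}-p_{2i-1}}}{(R_{i,1})^{p_{2i+1}+p_{2i}-p_{2i-1}-p_{2i-2}}}\ \binom{p_1+p_2}{p_1}\prod_{\ell=1}^{r}C(p_{2\ell},p_{2\ell+1},p_{2\ell+2}),$$ where $p_0=p_{2r+2}=0$ and, for integers $a,b,c\ge 0$, $$C(a,b,c)=\begin{cases}\dfrac{(a+b+c-1)!}{(a-1)!\,b!\,c!}& a\ge 1,\\ 1& a=b=c=0,\\ 0& a=0,\ (b,c)\neq(0,0).\end{cases}$$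
   Context: The $A_r$ $Q$-system is the system of recursion relations $R_{\alpha,n+1}R_{\alpha,n-1}=R_{\alpha,n}^2+R_{\alpha+1,n}R_{\alpha-1,n}$ for $1\le\alpha\le r$ and $n\in\mathbb Z$, with boundary conditions $R_{0,n}=R_{r+1,n}=1$ for all $n\in\mathbb Z$. The initial data $R_{\alpha,0},R_{\alpha,1}$ ($1\le\alpha\le r$) are independent indeterminates, and all $R_{\alpha,n}$ lie in the field of rational functions in them. *)

theory Defs
  imports
    "HOL-Library.Poly_Mapping"
    "HOL-Library.Product_Lexorder"
    "HOL-Computational_Algebra.Fraction_Field"
begin

text \<open>
  Polynomials over \<open>'k\<close> in indeterminates indexed by \<open>'v\<close> are finitely supported maps from
  monomials \<open>'v \<Rightarrow>\<^sub>0 nat\<close> to \<open>'k\<close>; for linearly ordered \<open>'v\<close> they form an integral domain.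
\<close>

type_synonym ('v, 'k) ratfun = "(('v \<Rightarrow>\<^sub>0 nat) \<Rightarrow>\<^sub>0 'k) fract"

definition indet :: "'v::linorder \<Rightarrow> ('v, 'k::field_char_0) ratfun" where
  "indet v = Fract (Poly_Mapping.single (Poly_Mapping.single v 1) 1) 1"

instance fract :: ("{idom, ring_char_0}") field_char_0
proof
  show "inj (of_nat :: nat \<Rightarrow> 'a fract)"
    by (rule injI) (simp add: of_nat_fract eq_fract)
qed

definition Q_system :: "nat \<Rightarrow> (nat \<Rightarrow> int \<Rightarrow> 'a::field) \<Rightarrow> bool" where
  "Q_system r R \<longleftrightarrow>
     (\<forall>n. R 0 n = 1 \<and> R (r + 1) n = 1) \<and>
     (\<forall>\<alpha>\<in>{1..r}. \<forall>n.
        R \<alpha> (n + 1) * R \<alpha> (n - 1) = (R \<alpha> n)^2 + R (\<alpha> + 1) n * R (\<alpha> - 1) n)"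

definition C :: "nat \<Rightarrow> nat \<Rightarrow> nat \<Rightarrow> 'a::field_char_0" where
  "C a b c =
     (if a \<ge> 1 then fact (a + b + c - 1) / (fact (a - 1) * fact b * fact c)
      else if b = 0 \<and> c = 0 then 1
      else 0)"

text \<open>
  A tuple \<open>(p\<^sub>1, \<dots>, p\<^sub>m)\<close> is extended by zero to all indices, so that \<open>p 0 = p (m + 1) = 0\<close>.
\<close>

definition tuples_with_sum :: "nat \<Rightarrow> nat \<Rightarrow> (nat \<Rightarrow> nat) set" where
  "tuples_with_sum m n = {p. (\<forall>i. i \<notin> {1..m} \<longrightarrow> p i = 0) \<and> (\<Sum>i=1..m. p i) = n}"

lemma finite_tuples_with_sum: "finite (tuples_with_sum m n)"
proof (rule finite_subset)
  show "tuples_with_sum m n \<subseteq> {p. \<forall>i. (i \<in> {1..m} \<longrightarrow> p i \<in> {..n}) \<and> (i \<notin> {1..m} \<longrightarrow> p i = 0)}"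
    by (auto simp: tuples_with_sum_def intro!: member_le_sum)
  show "finite {p. \<forall>i. (i \<in> {1..m} \<longrightarrow> p i \<in> {..n}) \<and> (i \<notin> {1..m} \<longrightarrow> p i = (0::nat))}"
    by (intro finite_set_of_finite_funs) auto
qed

end

theory Submission
  imports Defs "HOL-Computational_Algebra.Formal_Power_Series"
begin

text \<open>
  Let \<open>F\<^sub>k\<close> be the generating function of \<open>R 1 (k + n + 1) / R 1 (k + 1)\<close> over \<open>n\<close>. It equals the
  finite continued fraction \<open>1/(1 - t a\<^sub>0 - t b\<^sub>0/(1 - t a\<^sub>1 - t b\<^sub>1/(\<dots> 1 - t a\<^sub>r)))\<close>, whose coefficients are
  Laurent monomials in the values of \<open>R\<close> at the times \<open>k\<close> and \<open>k + 1\<close>: rearranging the fraction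
  shows that it satisfies \<open>F\<^sub>k = 1 + t (a\<^sub>0 + b\<^sub>0) F\<^sub>k\<^sub>+\<^sub>1\<close>, where the Q-system is exactly the rule
  that carries the coefficients from time \<open>k\<close> to \<open>k + 1\<close>. Expanding level by level, with \<open>C a b c\<close>
  the coefficient of \<open>x\<^sup>b y\<^sup>c\<close> in the \<open>-a\<close>-th power of \<open>1 - x - y\<close>, gives the sum over tuples. The
  divisions are legitimate since the Q-system produces subtraction-free expressions in the initial
  data, which do not vanish in characteristic zero.
\<close>

section \<open>Sums over tuples supported on a finite index set\<close>

definition tuples_on :: "nat set \<Rightarrow> nat \<Rightarrow> (nat \<Rightarrow> nat) set" where
  "tuples_on J n = {p. (\<forall>i. i \<notin> J \<longrightarrow> p i = 0) \<and> sum p J = n}"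

lemma finite_tuples_on:
  assumes "finite J"
  shows "finite (tuples_on J n)"
proof (rule finite_subset)
  show "tuples_on J n \<subseteq> {p. \<forall>i. (i \<in> J \<longrightarrow> p i \<in> {..n}) \<and> (i \<notin> J \<longrightarrow> p i = 0)}"
    using assms by (auto simp: tuples_on_def intro!: member_le_sum)
  show "finite {p. \<forall>i. (i \<in> J \<longrightarrow> p i \<in> {..n}) \<and> (i \<notin> J \<longrightarrow> p i = (0::nat))}"
    using assms by (intro finite_set_of_finite_funs) auto
qed

lemma tuples_on_empty: "tuples_on {} n = (if n = 0 then {\<lambda>_. 0} else {})"
  by (auto simp: tuples_on_def)

lemma sum_tuples_on_insert:
  fixes g :: "(nat \<Rightarrow> nat) \<Rightarrow> 'a::comm_monoid_add"
  assumes J: "finite J" "j \<notin> J"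
  shows "(\<Sum>p\<in>tuples_on (insert j J) n. g p) =
         (\<Sum>b\<le>n. \<Sum>q\<in>tuples_on J (n - b). g (q(j := b)))"
proof -
  have cong: "(\<Sum>x\<in>J. if x = j then b else q x) = sum q J" for q :: "nat \<Rightarrow> nat" and b
    using J by (intro sum.cong) auto
  have "(\<Sum>b\<le>n. \<Sum>q\<in>tuples_on J (n - b). g (q(j := b))) =
        (\<Sum>(b, q)\<in>(SIGMA b:{..n}. tuples_on J (n - b)). g (q(j := b)))"
    using J by (subst sum.Sigma) (auto simp: finite_tuples_on)
  also have "\<dots> = (\<Sum>p\<in>tuples_on (insert j J) n. g p)"
    using J
    by (intro sum.reindex_bij_witness[where i = "\<lambda>p. (p j, p(j := 0))"
                                       and j = "\<lambda>(b, q). q(j := b)"])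
       (auto simp: tuples_on_def fun_upd_def cong fun_eq_iff)
  finally show ?thesis ..
qed

section \<open>Negative powers of power series\<close>

text \<open>Truncated subtraction covers \<open>a = 0\<close>: \<open>(k - 1) choose k\<close> is 0
  for \<open>k > 0\<close> and 1 for \<open>k = 0\<close>, matching the convention in
  \<open>C\<close>.\<close>

lemma C_eq_binomials:
  "C a b c = of_nat (((a + (b + c) - 1) choose (b + c)) * ((b + c) choose b))"
proof (cases a)
  case 0
  then show ?thesis by (cases "b + c") (auto simp: C_def)
next
  case (Suc a')
  then show ?thesis
    by (simp add: C_def binomial_fact add.commute add.left_commute)
qed

text \<open>Substitute \<open>fps_X * u\<close>, whose constant term is 0, for the variable in the
  negative binomial series.\<close>

lemma inverse_one_minus_X_mult_power_nth:
  fixes u :: "'a::field_char_0 fps"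
  shows "fps_nth (inverse (1 - fps_X * u) ^ m) n =
    (\<Sum>k\<le>n. of_nat ((m + k - 1) choose k) * fps_nth (u ^ k) (n - k))"
proof -
  have [simp]: "fps_nth (fps_X * u) 0 = 0" by simp
  have "inverse (1 - fps_X * u) ^ m = inverse ((1 - fps_X :: 'a fps) ^ m) oo (fps_X * u)"
    by (simp add: fps_inverse_power fps_inverse_compose fps_compose_sub_distrib
                  flip: fps_compose_power)
  also have "inverse ((1 - fps_X :: 'a fps) ^ m) = Abs_fps (\<lambda>k. of_nat ((m + k - 1) choose k))"
    using one_minus_const_fps_X_neg_power'[of m "1::'a"]
    by (cases "m = 0") (auto simp: fps_eq_iff binomial_eq_0)
  finally show ?thesis
    by (auto simp: fps_compose_nth power_mult_distrib fps_X_power_mult_nth atLeast0AtMost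
             intro!: sum.cong)
qed

section \<open>Continued fractions and their passage to the next time\<close>

primrec cfrac :: "(nat \<Rightarrow> 'a) \<Rightarrow> (nat \<Rightarrow> 'a) \<Rightarrow> nat \<Rightarrow> nat \<Rightarrow> 'a::field fps" where
  "cfrac a b i 0 = fps_const (a i)"
| "cfrac a b i (Suc d) =
     fps_const (a i) + fps_const (b i) * inverse (1 - fps_X * cfrac a b (Suc i) d)"

text \<open>
  Here \<open>cfrac a b i d\<close> is the \<open>u\<close> in the tail \<open>1/(1 - t u)\<close> at level \<open>i\<close>. In the claim the
  outermost inverses are cleared, so that it propagates from the innermost level outwards; at level \<open>0\<close>, where
  \<open>a' 0 = s 0\<close>, it becomes the relation between the continued fractions at consecutive times.
\<close>

lemma cfrac_mutation:
  fixes a b a' b' s :: "nat \<Rightarrow> 'a::field"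
  assumes s_last: "s r = a r"
    and s: "\<And>i. i < r \<Longrightarrow> s i = a i + b i"
    and s_nz: "\<And>i. i < r \<Longrightarrow> s i \<noteq> 0"
    and a': "\<And>i. i < r \<Longrightarrow> a' (Suc i) * s i = a i * s (Suc i)"
    and b': "\<And>i. i < r \<Longrightarrow> b' i * s i = b i * s (Suc i)"
  shows "i + d = r \<Longrightarrow> cfrac a b i d =
    fps_const (s i) + fps_X * cfrac a b i d * (cfrac a' b' i d - fps_const (a' i))"
proof (induction d arbitrary: i)
  case 0
  then show ?case using s_last by simp
next
  case (Suc d)
  then have i: "i < r" by simp
  define A B A' B' S T where "A = fps_const (a i)" and "B = fps_const (b i)"
    and "A' = fps_const (a' (Suc i))" and "B' = fps_const (b' i)"
    and "S = fps_const (s i)" and "T = fps_const (s (Suc i))"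
  define V V' where "V = cfrac a b (Suc i) d" and "V' = cfrac a' b' (Suc i) d"
  define G G' where "G = inverse (1 - fps_X * V)" and "G' = inverse (1 - fps_X * V')"
  have G: "(1 - fps_X * V) * G = 1" "(1 - fps_X * V') * G' = 1"
    unfolding G_def G'_def by (auto intro!: inverse_mult_eq_1')
  have V: "V = T + fps_X * V * (V' - A')"
    unfolding V_def V'_def T_def A'_def using Suc by simp
  have rel: "S = A + B" "A' * S = A * T" "B' * S = B * T"
    unfolding S_def T_def A_def B_def A'_def B'_def using s[OF i] a'[OF i] b'[OF i] by simp_all
  \<comment> \<open>Multiplied by both denominators and \<open>S\<close>, the claim follows from
    \<open>G\<close>, \<open>V\<close> and \<open>rel\<close> by polynomial algebra; the multiplier
    is nonzero, so it cancels.\<close>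
  have "(1 - fps_X * V) * (1 - fps_X * V') * S \<noteq> 0"
    using G s_nz[OF i] by (auto simp: S_def)
  moreover have "(1 - fps_X * V) * (1 - fps_X * V') * S * (A + B * G) =
    (1 - fps_X * V) * (1 - fps_X * V') * S * (S + fps_X * (A + B * G) * (B' * G'))"
    using G V rel by algebra
  ultimately have "A + B * G = S + fps_X * (A + B * G) * (B' * G')"
    using mult_left_cancel by blast
  then show ?case
    by (simp add: A_def B_def B'_def S_def G_def G'_def V_def V'_def)
qed

section \<open>Expansion of the continued fraction over tuples\<close>

lemma sum_triangle_reindex:
  fixes f :: "nat \<Rightarrow> nat \<Rightarrow> 'a::comm_monoid_add"
  shows "(\<Sum>k\<le>n. \<Sum>j\<le>k. f k j) = (\<Sum>b\<le>n. \<Sum>c\<le>n - b. f (b + c) b)"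
  by (simp add: sum.Sigma)
     (rule sum.reindex_bij_witness[where i = "\<lambda>(b, c). (b + c, b)" and j = "\<lambda>(k, j). (j, k - j)"],
      auto)

text \<open>The entries \<open>p (2*l+1)\<close> and \<open>p (2*l+2)\<close> count the factors
  \<open>a l\<close> and \<open>b l\<close> picked at level \<open>l\<close>. Each
  \<open>b l\<close> brings one copy of the next inner fraction, so \<open>p (2*l+2)\<close> is also
  the power that \<open>C\<close> expands.\<close>

definition cfrac_weight ::
    "(nat \<Rightarrow> 'a) \<Rightarrow> (nat \<Rightarrow> 'a) \<Rightarrow> nat \<Rightarrow> nat \<Rightarrow> (nat \<Rightarrow> nat) \<Rightarrow> 'a::field_char_0" where
  "cfrac_weight a b i d p =
     (\<Prod>l\<in>{i..<i + d}. a l ^ p (2*l+1) * b l ^ p (2*l+2) * C (p (2*l+2)) (p (2*l+3)) (p (2*l+4))) *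
     a (i + d) ^ p (2*(i + d)+1)"

text \<open>The power \<open>m\<close> must be arbitrary: the outermost level yields
  \<open>C m e c * a i ^ e * b i ^ c\<close> times the \<open>c\<close>-th power of the inner
  fraction, which the induction hypothesis expands.\<close>

lemma inverse_one_minus_X_cfrac_power_nth:
  fixes a b :: "nat \<Rightarrow> 'a::field_char_0"
  shows "fps_nth (inverse (1 - fps_X * cfrac a b i d) ^ m) n =
    (\<Sum>p\<in>tuples_on {2*i+1..2*(i+d)+1} n. C m (p (2*i+1)) (p (2*i+2)) * cfrac_weight a b i d p)"
proof (induction d arbitrary: i m n)
  case 0
  \<comment> \<open>The innermost level is constant, so only \<open>k = n\<close>
    contributes.\<close>
  have "fps_nth (inverse (1 - fps_X * cfrac a b i 0) ^ m) n =
        (\<Sum>k\<le>n. if k = n then C m n 0 * a i ^ n else 0)"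
    unfolding inverse_one_minus_X_mult_power_nth
    by (intro sum.cong) (auto simp: C_eq_binomials fps_const_power)
  also have "\<dots> = C m n 0 * a i ^ n" by simp
  also have "\<dots> = (\<Sum>p\<in>tuples_on {2*i+1} n. C m (p (2*i+1)) (p (2*i+2)) * cfrac_weight a b i 0 p)"
    by (subst sum_tuples_on_insert)
       (auto simp: tuples_on_empty cfrac_weight_def if_distrib cong: if_cong)
  finally show ?case by simp
next
  case (Suc d)
  let ?J = "{2 * Suc i + 1..2 * (Suc i + d) + 1}"
  define G where "G = inverse (1 - fps_X * cfrac a b (Suc i) d)"
  have J: "{2*i+1..2*(i + Suc d)+1} = insert (2*i+1) (insert (2*i+2) ?J)"
    by auto
  have weight: "C m ((q(2*i+2 := c, 2*i+1 := e)) (2*i+1)) ((q(2*i+2 := c, 2*i+1 := e)) (2*i+2)) *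
        cfrac_weight a b i (Suc d) (q(2*i+2 := c, 2*i+1 := e)) =
      C m e c * a i ^ e * b i ^ c *
        (C c (q (2 * Suc i + 1)) (q (2 * Suc i + 2)) * cfrac_weight a b (Suc i) d q)"
    for q c e
  proof -
    let ?q = "q(2*i+2 := c, 2*i+1 := e)"
    let ?f = "\<lambda>p l. a l ^ p (2*l+1) * b l ^ p (2*l+2) * C (p (2*l+2)) (p (2*l+3)) (p (2*l+4))"
    have "prod (?f ?q) {i..<i + Suc d} = ?f ?q i * prod (?f ?q) {Suc i..<Suc i + d}"
      by (subst prod.atLeast_Suc_lessThan) auto
    also have "prod (?f ?q) {Suc i..<Suc i + d} = prod (?f q) {Suc i..<Suc i + d}"
      by (intro prod.cong) auto
    also have "?f ?q i = a i ^ e * b i ^ c * C c (q (2 * Suc i + 1)) (q (2 * Suc i + 2))"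
      by (simp add: numeral_eq_Suc)
    finally have split: "prod (?f ?q) {i..<i + Suc d} = \<dots> * prod (?f q) {Suc i..<Suc i + d}" .
    have last: "a (i + Suc d) ^ ?q (2*(i + Suc d)+1) = a (Suc i + d) ^ q (2*(Suc i + d)+1)"
      by simp
    have "cfrac_weight a b i (Suc d) ?q = a i ^ e * b i ^ c *
        C c (q (2 * Suc i + 1)) (q (2 * Suc i + 2)) * cfrac_weight a b (Suc i) d q"
      unfolding cfrac_weight_def split last by (simp only: mult.assoc)
    then show ?thesis by (simp add: mult_ac)
  qed
  have binom: "fps_nth ((fps_const (a i) + fps_const (b i) * G) ^ k) n' =
      (\<Sum>j\<le>k. of_nat (k choose j) * a i ^ j * b i ^ (k - j) * fps_nth (G ^ (k - j)) n')" for k n'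
    by (simp add: binomial_ring fps_sum_nth power_mult_distrib fps_const_power mult.assoc
             flip: fps_of_nat)
  have "fps_nth (inverse (1 - fps_X * cfrac a b i (Suc d)) ^ m) n =
    (\<Sum>k\<le>n. \<Sum>j\<le>k. of_nat ((m + k - 1) choose k) *
      (of_nat (k choose j) * a i ^ j * b i ^ (k - j) * fps_nth (G ^ (k - j)) (n - k)))"
    unfolding inverse_one_minus_X_mult_power_nth cfrac.simps G_def[symmetric] binom
    by (simp add: sum_distrib_left)
  \<comment> \<open>With \<open>e = j\<close> and \<open>c = k - j\<close>, the two binomials
    combine into \<open>C m e c\<close>.\<close>
  also have "\<dots> = (\<Sum>e\<le>n. \<Sum>c\<le>n - e. C m e c * a i ^ e * b i ^ c * fps_nth (G ^ c) (n - e - c))"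
    by (subst sum_triangle_reindex) (simp add: C_eq_binomials mult.assoc)
  also have "\<dots> = (\<Sum>e\<le>n. \<Sum>c\<le>n - e. \<Sum>q\<in>tuples_on ?J (n - e - c). C m e c * a i ^ e * b i ^ c *
        (C c (q (2 * Suc i + 1)) (q (2 * Suc i + 2)) * cfrac_weight a b (Suc i) d q))"
    unfolding G_def Suc.IH sum_distrib_left ..
  also have "\<dots> = (\<Sum>p\<in>tuples_on {2*i+1..2*(i + Suc d)+1} n.
      C m (p (2*i+1)) (p (2*i+2)) * cfrac_weight a b i (Suc d) p)"
    unfolding J
    by (subst sum_tuples_on_insert, simp, simp, subst sum_tuples_on_insert, simp, simp,
        simp only: weight)
  finally show ?case .
qed

section \<open>Nonvanishing through positivity\<close>

text \<open>
  The field \<open>'k\<close> carries no order; coefficients in \<open>\<nat>\<close> replace nonnegative ones.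
\<close>

definition nonneg_poly :: "(('v \<Rightarrow>\<^sub>0 nat) \<Rightarrow>\<^sub>0 'k::semiring_1) \<Rightarrow> bool" where
  "nonneg_poly p \<longleftrightarrow> p \<noteq> 0 \<and> (\<forall>m. Poly_Mapping.lookup p m \<in> \<nat>)"

text \<open>Nothing cancels: in characteristic 0 a sum of two naturals, one of them nonzero, is
  nonzero.\<close>

lemma nonneg_poly_add:
  fixes p q :: "('v \<Rightarrow>\<^sub>0 nat) \<Rightarrow>\<^sub>0 'k::field_char_0"
  assumes "nonneg_poly p" "nonneg_poly q"
  shows "nonneg_poly (p + q)"
proof -
  obtain m where m: "Poly_Mapping.lookup p m \<noteq> 0"
    using assms unfolding nonneg_poly_def by (metis lookup_zero poly_mapping_eqI)
  obtain k l where kl: "Poly_Mapping.lookup p m = of_nat k" "Poly_Mapping.lookup q m = of_nat l"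
    using assms unfolding nonneg_poly_def by (meson Nats_cases)
  have "Poly_Mapping.lookup (p + q) m = of_nat (k + l)"
    by (simp add: lookup_add kl)
  moreover have "k + l \<noteq> 0" using m kl by auto
  ultimately have "Poly_Mapping.lookup (p + q) m \<noteq> 0" by (metis of_nat_eq_0_iff)
  then show ?thesis
    using assms by (auto simp: nonneg_poly_def lookup_add dest: arg_cong[where f = "\<lambda>f. Poly_Mapping.lookup f m"])
qed

lemma nonneg_poly_mult:
  fixes p q :: "('v::linorder \<Rightarrow>\<^sub>0 nat) \<Rightarrow>\<^sub>0 'k::field_char_0"
  assumes "nonneg_poly p" "nonneg_poly q"
  shows "nonneg_poly (p * q)"
proof -
  have sum_any: "Sum_any f \<in> \<nat>" if "\<And>x. f x \<in> \<nat>" for f :: "('v \<Rightarrow>\<^sub>0 nat) \<Rightarrow> 'k"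
    
  proof -
    have "sum f S \<in> \<nat>" for S
      using that by (induction S rule: infinite_finite_induct) auto
    then show ?thesis by (simp add: Sum_any.expand_set)
  qed
  show ?thesis
    using assms by (auto simp: nonneg_poly_def lookup_mult when_def intro!: sum_any Nats_mult)
qed

definition subtraction_free :: "('v::linorder, 'k::field_char_0) ratfun set" where
  "subtraction_free = {Fraction_Field.Fract p q | p q. nonneg_poly p \<and> nonneg_poly q}"

lemma subtraction_free_nonzero: "x \<in> subtraction_free \<Longrightarrow> x \<noteq> 0"
  by (auto simp: subtraction_free_def nonneg_poly_def Zero_fract_def eq_fract)

lemma subtraction_free_add:
  "x \<in> subtraction_free \<Longrightarrow> y \<in> subtraction_free \<Longrightarrow> x + y \<in> subtraction_free"
  unfolding subtraction_free_def
  by clarsimp (metis add_fract nonneg_poly_add nonneg_poly_mult nonneg_poly_def)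

lemma subtraction_free_mult:
  "x \<in> subtraction_free \<Longrightarrow> y \<in> subtraction_free \<Longrightarrow> x * y \<in> subtraction_free"
  unfolding subtraction_free_def
  by clarsimp (metis mult_fract nonneg_poly_mult)

lemma subtraction_free_divide:
  "x \<in> subtraction_free \<Longrightarrow> y \<in> subtraction_free \<Longrightarrow> x / y \<in> subtraction_free"
  unfolding subtraction_free_def
  by clarsimp (metis divide_fract nonneg_poly_mult)

lemma subtraction_free_1: "1 \<in> subtraction_free"
  unfolding subtraction_free_def One_fract_def
  by (auto simp: nonneg_poly_def lookup_one when_def intro!: exI[of _ 1])

lemma subtraction_free_indet: "indet v \<in> subtraction_free"
proof -
  have "nonneg_poly (Poly_Mapping.single (Poly_Mapping.single v 1) 1 :: ('a \<Rightarrow>\<^sub>0 nat) \<Rightarrow>\<^sub>0 'b)"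
    by (auto simp: nonneg_poly_def lookup_single when_def
             dest: arg_cong[where f = "\<lambda>f. Poly_Mapping.lookup f (Poly_Mapping.single v 1)"])
  moreover have "nonneg_poly (1 :: ('a \<Rightarrow>\<^sub>0 nat) \<Rightarrow>\<^sub>0 'b)"
    by (auto simp: nonneg_poly_def lookup_one when_def)
  ultimately show ?thesis
    unfolding subtraction_free_def indet_def by blast
qed

text \<open>Solved for its latest value, the recursion uses only sums, products and division by an
  earlier value. It involves neighbours of \<alpha>, so the induction on time treats all \<alpha> at
  once.\<close>

lemma Q_system_subtraction_free:
  fixes R :: "nat \<Rightarrow> int \<Rightarrow> ('v::linorder, 'k::field_char_0) ratfun"
  assumes Q: "Q_system r R"
    and init: "\<And>\<alpha>. \<alpha> \<in> {1..r} \<Longrightarrow> R \<alpha> 0 \<in> subtraction_free \<and> R \<alpha> 1 \<in> subtraction_free"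
  shows "\<alpha> \<le> r + 1 \<Longrightarrow> R \<alpha> (int n) \<in> subtraction_free"
proof (induction n arbitrary: \<alpha> rule: less_induct)
  case (less n)
  consider "\<alpha> = 0 \<or> \<alpha> = r + 1" | "\<alpha> \<in> {1..r}" "n \<le> 1" | "\<alpha> \<in> {1..r}" "n \<ge> 2"
    using less.prems by fastforce
  then show ?case
  proof cases
    case 1
    then show ?thesis using Q by (auto simp: Q_system_def subtraction_free_1)
  next
    case 2
    then show ?thesis using init by (cases n) auto
  next
    case 3
    then obtain k where n: "n = Suc (Suc k)"
      by (metis Suc_diff_Suc Suc_le_lessD numeral_2_eq_2 add_2_eq_Suc le_iff_add)
    have k: "R \<alpha> (int k) \<in> subtraction_free" using less.IH[of k \<alpha>] 3 n by simp
    have "R \<alpha> (int (Suc k) + 1) * R \<alpha> (int (Suc k) - 1) =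
        (R \<alpha> (int (Suc k)))^2 + R (\<alpha> + 1) (int (Suc k)) * R (\<alpha> - 1) (int (Suc k))"
      using Q 3 unfolding Q_system_def by blast
    then have "R \<alpha> (int n) = (R \<alpha> (int (Suc k)) * R \<alpha> (int (Suc k)) +
        R (\<alpha> + 1) (int (Suc k)) * R (\<alpha> - 1) (int (Suc k))) / R \<alpha> (int k)"
      using subtraction_free_nonzero[OF k] by (simp add: n field_simps power2_eq_square)
    also have "\<dots> \<in> subtraction_free"
      using 3 n less.IH[of "Suc k"] k
      by (intro subtraction_free_divide subtraction_free_add subtraction_free_mult) auto
    finally show ?thesis .
  qed
qed

section \<open>From the Q-system to the tuple sum\<close>

text \<open>Each \<open>A i\<close> and \<open>B i\<close> occurs in several neighbouring levels, so
  stopping at \<open>m\<close> leaves the trailing factor. At \<open>m = r\<close> it cancels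
  against the innermost coefficient, by the boundary values and
  \<open>p (2*r+2) = 0\<close>.\<close>

lemma prod_cfrac_coeffs_eq:
  fixes A B :: "nat \<Rightarrow> 'a::field" and p :: "nat \<Rightarrow> nat"
  assumes nz: "\<And>i. i \<le> Suc r \<Longrightarrow> A i \<noteq> 0" "\<And>i. i \<le> Suc r \<Longrightarrow> B i \<noteq> 0"
    and init: "A 0 = 1" "B 0 = 1" "p 0 = 0"
  shows "m \<le> r \<Longrightarrow>
    (\<Prod>l<m. (B (l+1) * A l / (A (l+1) * B l)) ^ p (2*l+1) *
            (A l * B (l+2) / (A (l+1) * B (l+1))) ^ p (2*l+2)) =
    (\<Prod>i=1..m.
       A i powi (int (p (2*i+2)) + int (p (2*i+1)) - int (p (2*i)) - int (p (2*i-1))) /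
       B i powi (int (p (2*i+1)) + int (p (2*i)) - int (p (2*i-1)) - int (p (2*i-2)))) *
    B m ^ p (2*m+1) * B (Suc m) ^ p (2*m) / A m ^ (p (2*m+2) + p (2*m+1))"
proof (induction m)
  case 0
  then show ?case using init by simp
next
  case (Suc m)
  then have [simp]: "A m \<noteq> 0" "A (Suc m) \<noteq> 0" "B m \<noteq> 0" "B (Suc m) \<noteq> 0" "B (Suc (Suc m)) \<noteq> 0"
    using nz by auto
  show ?case
    using Suc
    by (simp add: power_int_add power_int_diff power_add power_divide power_mult_distrib field_simps)
qed

text \<open>Each passage from time \<open>k\<close> to \<open>k + 1\<close> contributes the ratio
  \<open>R 1 (k+2) / R 1 (k+1)\<close>; these ratios telescope.\<close>

lemma Q_system_cfrac_nth:
  fixes R :: "nat \<Rightarrow> nat \<Rightarrow> 'a::field"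
  assumes bdry: "\<And>n. R 0 n = 1" "\<And>n. R (Suc r) n = 1"
    and rec: "\<And>i n. i < r \<Longrightarrow> R (i+1) (n+2) * R (i+1) n = (R (i+1) (n+1))^2 + R (i+2) (n+1) * R i (n+1)"
    and nz: "\<And>i n. i \<le> Suc r \<Longrightarrow> R i n \<noteq> 0"
  defines "a \<equiv> \<lambda>k i. R (i+1) (k+1) * R i k / (R (i+1) k * R i (k+1))"
    and "b \<equiv> \<lambda>k i. R i k * R (i+2) (k+1) / (R (i+1) k * R (i+1) (k+1))"
  shows "fps_nth (inverse (1 - fps_X * cfrac (a k) (b k) 0 r)) n = R 1 (k+n+1) / R 1 (k+1)"
proof (induction n arbitrary: k)
  case 0
  then show ?case using nz[of 1] by simp
next
  case (Suc n)
  \<comment> \<open>By the Q-system this is a closed form of \<open>a k i + b k i\<close> for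
    \<open>i < r\<close>; at \<open>i = r\<close> the boundary values reduce it to
    \<open>a k r\<close>.\<close>
  define s where "s = (\<lambda>i. R i k * R (i+1) (k+2) / (R i (k+1) * R (i+1) (k+1)))"
  define U U' where "U = cfrac (a k) (b k) 0 r" and "U' = cfrac (a (Suc k)) (b (Suc k)) 0 r"
  define G G' where "G = inverse (1 - fps_X * U)" and "G' = inverse (1 - fps_X * U')"
  have G: "(1 - fps_X * U) * G = 1" "(1 - fps_X * U') * G' = 1"
    unfolding G_def G'_def by (auto intro!: inverse_mult_eq_1')
  have "U = fps_const (s 0) + fps_X * U * (U' - fps_const (a (Suc k) 0))"
    unfolding U_def U'_def
  proof (rule cfrac_mutation[where r = r])
    show "s r = a k r" by (simp add: s_def a_def bdry)
    fix i assume i: "i < r"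
    have [simp]: "R i n \<noteq> 0" "R (Suc i) n \<noteq> 0" "R (Suc (Suc i)) n \<noteq> 0" for n
      using nz i by auto
    show "s i \<noteq> 0" by (simp add: s_def)
    show "s i = a k i + b k i"
      using rec[OF i, of k] by (simp add: s_def a_def b_def field_simps power2_eq_square)
    show "a (Suc k) (Suc i) * s i = a k i * s (Suc i)" "b (Suc k) i * s i = b k i * s (Suc i)"
      by (simp_all add: s_def a_def b_def field_simps)
  qed simp
  moreover have "s 0 = a (Suc k) 0" by (simp add: s_def a_def bdry)
  ultimately have "U = fps_const (s 0) + fps_X * U * (U' - fps_const (s 0))" by simp
  \<comment> \<open>The relation rearranges to
    \<open>U * (1 - fps_X * U') = s 0 * (1 - fps_X * U)\<close>, that is
    \<open>U * G = s 0 * G'\<close>; insert this into \<open>G = 1 + fps_X * U * G\<close>.\<close>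
  then have "G = 1 + fps_X * (fps_const (s 0) * G')"
    using G by algebra
  then have "fps_nth G (Suc n) = s 0 * fps_nth G' n" by simp
  then show ?case
    using Suc[of "Suc k"] nz[of 1] unfolding G_def G'_def U_def U'_def
    by (simp add: s_def bdry)
qed

theorem mainTheorem3:
  fixes r n :: nat
    and R :: "nat \<Rightarrow> int \<Rightarrow> (nat \<times> nat, 'k::field_char_0) ratfun"
  assumes "r \<ge> 1"
    and "Q_system r R"
    and "\<And>\<alpha>. \<alpha> \<in> {1..r} \<Longrightarrow> R \<alpha> 0 = indet (\<alpha>, 0) \<and> R \<alpha> 1 = indet (\<alpha>, 1)"
  shows "R 1 (int n + 1) = R 1 1 *
    (\<Sum>p\<in>tuples_with_sum (2 * r + 1) n.
       (\<Prod>i=1..r.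
          R i 0 powi (int (p (2*i+2)) + int (p (2*i+1)) - int (p (2*i)) - int (p (2*i-1))) /
          R i 1 powi (int (p (2*i+1)) + int (p (2*i)) - int (p (2*i-1)) - int (p (2*i-2)))) *
       of_nat ((p 1 + p 2) choose (p 1)) *
       (\<Prod>l=1..r. C (p (2*l)) (p (2*l+1)) (p (2*l+2))))"
proof -
  define Q where "Q = (\<lambda>\<alpha> n. R \<alpha> (int n))"
  define a b where "a = (\<lambda>k i. Q (i+1) (k+1) * Q i k / (Q (i+1) k * Q i (k+1)))"
    and "b = (\<lambda>k i. Q i k * Q (i+2) (k+1) / (Q (i+1) k * Q (i+1) (k+1)))"
  have nz: "Q i k \<noteq> 0" if "i \<le> Suc r" for i k
    unfolding Q_def using assms(3) that
    by (intro subtraction_free_nonzero Q_system_subtraction_free[OF assms(2)])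
       (auto simp: subtraction_free_indet)
  have bdry: "Q 0 k = 1" "Q (Suc r) k = 1" for k
    using assms(2) by (auto simp: Q_system_def Q_def)
  have rec: "Q (i+1) (k+2) * Q (i+1) k = (Q (i+1) (k+1))^2 + Q (i+2) (k+1) * Q i (k+1)"
    if "i < r" for i k
  proof -
    have "i + 1 \<in> {1..r}" using that by simp
    then have "R (i+1) (int (k+1) + 1) * R (i+1) (int (k+1) - 1) =
        (R (i+1) (int (k+1)))^2 + R (i+1+1) (int (k+1)) * R (i+1-1) (int (k+1))"
      using assms(2) unfolding Q_system_def by blast
    then show ?thesis by (simp add: Q_def add.commute)
  qed
  have summand: "C 1 (p 1) (p 2) * cfrac_weight (a 0) (b 0) 0 r p =
      (\<Prod>i=1..r.
          R i 0 powi (int (p (2*i+2)) + int (p (2*i+1)) - int (p (2*i)) - int (p (2*i-1))) /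
          R i 1 powi (int (p (2*i+1)) + int (p (2*i)) - int (p (2*i-1)) - int (p (2*i-2)))) *
       of_nat ((p 1 + p 2) choose (p 1)) *
       (\<Prod>l=1..r. C (p (2*l)) (p (2*l+1)) (p (2*l+2)))"
    if "p \<in> tuples_on {1..2*r+1} n" for p
  proof -
    have p: "p 0 = 0" "p (2*r+2) = 0" using that by (auto simp: tuples_on_def)
    have C: "(\<Prod>l<r. C (p (2*l+2)) (p (2*l+3)) (p (2*l+4))) =
        (\<Prod>l=1..r. C (p (2*l)) (p (2*l+1)) (p (2*l+2)) :: (nat \<times> nat, 'k) ratfun)"
      by (intro prod.reindex_bij_witness[where i = "\<lambda>l. l - 1" and j = Suc])
         (auto simp: numeral_eq_Suc)
    have monomial: "(\<Prod>l<r. a 0 l ^ p (2*l+1) * b 0 l ^ p (2*l+2)) * a 0 r ^ p (2*r+1) =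
      (\<Prod>i=1..r.
          R i 0 powi (int (p (2*i+2)) + int (p (2*i+1)) - int (p (2*i)) - int (p (2*i-1))) /
          R i 1 powi (int (p (2*i+1)) + int (p (2*i)) - int (p (2*i-1)) - int (p (2*i-2))))"
      using prod_cfrac_coeffs_eq[of r "\<lambda>i. Q i 0" "\<lambda>i. Q i 1" p r] nz[of r] nz bdry p
      by (simp add: a_def b_def field_simps power_divide) (simp add: Q_def)
    have split: "cfrac_weight (a 0) (b 0) 0 r p =
        (\<Prod>l<r. a 0 l ^ p (2*l+1) * b 0 l ^ p (2*l+2)) * a 0 r ^ p (2*r+1) *
        (\<Prod>l<r. C (p (2*l+2)) (p (2*l+3)) (p (2*l+4)))"
      by (simp only: cfrac_weight_def prod.distrib add_0 atLeast0LessThan mult_ac)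
    \<comment> \<open>The outermost fraction enters to the power 1, which turns its \<open>C\<close>
      into a plain binomial.\<close>
    have "C 1 (p 1) (p 2) = (of_nat ((p 1 + p 2) choose (p 1)) :: (nat \<times> nat, 'k) ratfun)"
      by (simp add: C_eq_binomials)
    then show ?thesis
      by (simp only: split monomial C) (simp only: mult_ac)
  qed
  have "R 1 (int n + 1) / R 1 1 = fps_nth (inverse (1 - fps_X * cfrac (a 0) (b 0) 0 r)) n"
    using Q_system_cfrac_nth[of Q r 0 n] bdry rec nz unfolding a_def b_def
    by (simp add: Q_def add.commute)
  also have "\<dots> = (\<Sum>p\<in>tuples_on {1..2*r+1} n. C 1 (p 1) (p 2) * cfrac_weight (a 0) (b 0) 0 r p)"
    using inverse_one_minus_X_cfrac_power_nth[of "a 0" "b 0" 0 r 1 n]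
    by (simp add: numeral_2_eq_2)
  finally show ?thesis
    using nz[of 1 1] summand
    by (simp add: field_simps Q_def tuples_on_def tuples_with_sum_def)
qed

end
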